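(* For every $x>0$, $t\in\mathbb R$ and integer $N\ge1$, \[ M(x+t)=\sum_{n=0}^{N-1}(-1)^n\frac{\mathrm{He}_n(t)}{x^{n+1}}+\rho_N(x,t), \] where the remainder $\rho_N(x,t)$ (defined by this equation) satisfies \[ |\rho_N(x,t)|\le\frac{M_N(t)}{x^{N+1}},\qquad M_N(t):=\sup_{s\ge0}\bigl|\mathrm{He}_N(s+t)\bigr|e^{-ts-s^2/2}<\infty . \] In particular, this is an asymptotic expansion as $x\to\infty$, uniformly for $t$ in every compact interval: for every compact interval $I\subset\mathbb R$ and every $N\ge1$, $\sup_{t\in I}|\rho_N(x,t)|=O(x^{-N-1})$ as $x\to\infty$.
   Context: $M$ denotes the Mills ratio of the standard normal law, $M(z)=\dfrac{1-\Phi(z)}{\varphi(z)}=e^{z^2/2}\int_z^\infty e^{-u^2/2}\,du$ for $z\in\mathbb R$, where $\varphi(z)=(2\pi)^{-1/2}e^{-z^2/2}$ and $\Phi$ are the standard normal density and distribution function. $\mathrm{He}_n$ are the probabilists' Hermite polynomials, with generating function $e^{yz-z^2/2}=\sum_{n\ge0}\mathrm{He}_n(y)\frac{z^n}{n!}$. *)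

theory Defs
  imports "HOL-Probability.Probability" "HOL-Computational_Algebra.Formal_Power_Series"
begin

definition mills :: "real \<Rightarrow> real" where
  "mills z = (1 - cdf std_normal_distribution z) / std_normal_density z"

lemma mills_eq_integral:
  "mills z = exp (z\<^sup>2 / 2) * (LBINT u:{z..}. exp (- u\<^sup>2 / 2))"
proof -
  interpret real_distribution std_normal_distribution
    by (rule real_dist_normal_dist)
  have "1 - cdf std_normal_distribution z = measure std_normal_distribution {z<..}"
  proof -
    have "measure std_normal_distribution (space std_normal_distribution - {..z}) =
          1 - measure std_normal_distribution {..z}"
      by (rule prob_compl) simp
    moreover have "space std_normal_distribution - {..z} = {z<..}" by auto
    ultimately show ?thesis by (simp add: cdf_def)
  qed
  also have "\<dots> = (LBINT u:{z<..}. std_normal_density u)"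
  proof -
    have "measure std_normal_distribution {z<..} =
          integral\<^sup>L std_normal_distribution (indicator {z<..})"
      by simp
    also have "\<dots> = integral\<^sup>L lborel (\<lambda>u. std_normal_density u *\<^sub>R indicator {z<..} u)"
      by (rule integral_density) auto
    finally show ?thesis by (simp add: set_lebesgue_integral_def mult.commute)
  qed
  also have "\<dots> = (LBINT u:{z..}. std_normal_density u)"
    unfolding set_lebesgue_integral_def
  proof (rule integral_cong_AE)
    show "AE u in lborel. indicator {z<..} u *\<^sub>R std_normal_density u =
        indicator {z..} u *\<^sub>R std_normal_density u"
      using AE_lborel_singleton[of z] by eventually_elim (simp add: indicator_def)
  qed simp_all
  also have "\<dots> = 1 / sqrt (2 * pi) * (LBINT u:{z..}. exp (- u\<^sup>2 / 2))"
    unfolding std_normal_density_def by (rule set_integral_mult_right)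
  finally have tail: "1 - cdf std_normal_distribution z =
      1 / sqrt (2 * pi) * (LBINT u:{z..}. exp (- u\<^sup>2 / 2))" .
  have "(1 / sqrt (2 * pi) * I) / (1 / sqrt (2 * pi) * exp (- z\<^sup>2 / 2)) = exp (z\<^sup>2 / 2) * I"
    for I :: real
    by (simp add: exp_minus field_simps)
  then show ?thesis
    unfolding mills_def tail std_normal_density_def[of z] .
qed

text \<open>
  The value of the probabilists' Hermite polynomial at \<open>y\<close>, read off from the generating
  function \<open>exp (y z - z\<^sup>2 / 2)\<close> regarded as a formal power series in \<open>z\<close>; see
  \<open>hermite_generating_function\<close> for the convergent identity, which also determines the
  numbers uniquely.
\<close>
definition hermite :: "nat \<Rightarrow> real \<Rightarrow> real" where
  "hermite n y =
     fact n * fps_nth (fps_exp 1 oo (fps_const y * fps_X - fps_const (1/2) * fps_X\<^sup>2)) n"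


lemma fps_hermite_ODE_unique:
  fixes F G :: "real fps"
  assumes F: "fps_deriv F = (fps_const y - fps_X) * F"
    and G: "fps_deriv G = (fps_const y - fps_X) * G"
    and 0: "fps_nth F 0 = fps_nth G 0"
  shows "F = G"
proof (rule fps_ext)
  have rec: "fps_nth H (Suc n) = (y * fps_nth H n - (if n = 0 then 0 else fps_nth H (n - 1))) / real (Suc n)"
    if "fps_deriv H = (fps_const y - fps_X) * H" for H :: "real fps" and n
  proof -
    have "fps_nth (fps_deriv H) n = fps_nth ((fps_const y - fps_X) * H) n"
      using that by simp
    then show ?thesis
      by (simp add: left_diff_distrib field_simps)
  qed
  show "fps_nth F n = fps_nth G n" for n
  proof (induction n rule: less_induct)
    case (less n)
    show ?case
    proof (cases n)
      case 0
      then show ?thesis using assms(3) by simp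
    next
      case (Suc m)
      then show ?thesis using rec[OF F, of m] rec[OF G, of m] less[of m] less[of "m - 1"]
        by simp
    qed
  qed
qed

lemma hermite_generating_function:
  "(\<lambda>n. hermite n y * z ^ n / fact n) sums exp (y * z - z\<^sup>2 / 2)"
proof -
  define F where "F = fps_exp (1::real) oo (fps_const y * fps_X - fps_const (1/2) * fps_X\<^sup>2)"
  define B :: "real fps" where
    "B = Abs_fps (\<lambda>n. if even n then (- (1/2)) ^ (n div 2) / fact (n div 2) else 0)"
  have "fps_deriv F = (fps_const y - fps_X) * F"
    unfolding F_def
    by (subst fps_compose_deriv) (auto simp: power2_eq_square algebra_simps fps_numeral_fps_const simp flip: fps_const_mult)
  moreover have dB: "fps_deriv B = - fps_X * B"
  proof (rule fps_ext)
    fix n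
    show "fps_nth (fps_deriv B) n = fps_nth (- fps_X * B) n"
    proof (cases "even n")
      case True
      then show ?thesis by (auto simp: B_def)
    next
      case False
      then obtain k where n: "n = 2 * k + 1" by (auto elim: oddE)
      have "Suc n = 2 * Suc k" using n by simp
      have *: "real (2 * Suc k) * (c ^ Suc k / fact (Suc k)) = 2 * c * (c ^ k / fact k)"
        for c :: real
        by (simp add: divide_simps del: of_nat_Suc) (simp add: algebra_simps)
      have "fps_nth (fps_deriv B) n =
          real (2 * Suc k) * ((- (1/2)) ^ Suc k / fact (Suc k))"
        unfolding fps_deriv_nth Suc_eq_plus1[symmetric] \<open>Suc n = 2 * Suc k\<close>
        by (simp add: B_def del: mult_Suc_right fact_Suc power_Suc)
      also have "\<dots> = fps_nth (- fps_X * B) n"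
        unfolding * using n by (simp add: B_def)
      finally show ?thesis .
    qed
  qed
  then have "fps_deriv (fps_exp y * B) = (fps_const y - fps_X) * (fps_exp y * B)"
    by (simp add: algebra_simps)
  moreover have "fps_nth F 0 = fps_nth (fps_exp y * B) 0"
    by (simp add: F_def B_def)
  ultimately have FB: "F = fps_exp y * B"
    by (rule fps_hermite_ODE_unique)
  define a where "a n = (y * z) ^ n /\<^sub>R fact n" for n
  define b where "b n = fps_nth B n * z ^ n" for n
  have sa: "a sums exp (y * z)" "summable (\<lambda>n. norm (a n))"
    using exp_converges[of "y * z"] summable_norm_exp[of "y * z"]
    by (simp_all only: a_def[abs_def])
  have "strict_mono (\<lambda>k::nat. 2 * k)" by (simp add: strict_mono_def)
  have b0: "b n = 0" if "n \<notin> range (\<lambda>k. 2 * k)" for n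
    using that by (auto simp: b_def B_def elim!: evenE)
  have b2: "b (2 * k) = (- (z\<^sup>2 / 2)) ^ k /\<^sub>R fact k" for k
  proof -
    have "(- (z\<^sup>2 / 2)) ^ k = (- (1/2) * z\<^sup>2) ^ k" by simp
    also have "\<dots> = (- (1/2)) ^ k * z ^ (2 * k)"
      by (simp only: power_mult_distrib power_mult)
    finally have "(- (z\<^sup>2 / 2)) ^ k /\<^sub>R fact k =
        inverse (fact k) * ((- (1/2)) ^ k * z ^ (2 * k))"
      by (simp only: real_scaleR_def)
    moreover have "b (2 * k) = (- (1/2)) ^ k / fact k * z ^ (2 * k)"
      by (simp only: b_def B_def fps_nth_Abs_fps) simp
    ultimately show ?thesis by (simp only: divide_inverse mult_ac)
  qed
  have "(\<lambda>k. b (2 * k)) sums exp (- (z\<^sup>2 / 2))"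
    unfolding b2 by (rule exp_converges)
  then have sb: "b sums exp (- (z\<^sup>2 / 2))"
    using sums_mono_reindex[OF \<open>strict_mono (\<lambda>k::nat. 2 * k)\<close>] b0 by blast
  have "summable (\<lambda>k. norm (b (2 * k)))"
    unfolding b2 by (rule summable_norm_exp)
  then have nb: "summable (\<lambda>n. norm (b n))"
    using summable_mono_reindex[OF \<open>strict_mono (\<lambda>k::nat. 2 * k)\<close>, of "\<lambda>n. norm (b n)"] b0 by auto
  have "(\<lambda>n. \<Sum>i\<le>n. a i * b (n - i)) sums (suminf a * suminf b)"
    by (rule Cauchy_product_sums) (fact sa nb)+
  also have "suminf a * suminf b = exp (y * z - z\<^sup>2 / 2)"
    using sa(1) sb by (simp add: sums_iff flip: exp_add)
  also have "(\<lambda>n. \<Sum>i\<le>n. a i * b (n - i)) = (\<lambda>n. hermite n y * z ^ n / fact n)"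
  proof
    fix n
    have "hermite n y * z ^ n / fact n = fps_nth (fps_exp y * B) n * z ^ n"
      by (simp add: hermite_def FB flip: F_def)
    also have "\<dots> = (\<Sum>i\<le>n. a i * b (n - i))"
      unfolding fps_mult_nth atMost_atLeast0 sum_distrib_right
    proof (rule sum.cong)
      fix i assume "i \<in> {0..n}"
      then have "z ^ n = z ^ i * z ^ (n - i)" by (simp flip: power_add)
      then show "fps_nth (fps_exp y) i * fps_nth B (n - i) * z ^ n = a i * b (n - i)"
        by (simp add: a_def b_def power_mult_distrib field_simps)
    qed simp
    finally show "(\<Sum>i\<le>n. a i * b (n - i)) = hermite n y * z ^ n / fact n" by simp
  qed
  finally show ?thesis .
qed

definition mills_remainder :: "nat \<Rightarrow> real \<Rightarrow> real \<Rightarrow> real" where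
  "mills_remainder N x t =
     mills (x + t) - (\<Sum>n<N. (-1) ^ n * (hermite n t / x ^ (n + 1)))"

definition weighted_hermite :: "nat \<Rightarrow> real \<Rightarrow> real \<Rightarrow> real" where
  "weighted_hermite N t s = \<bar>hermite N (s + t)\<bar> * exp (- t * s - s\<^sup>2 / 2)"

text \<open>
  A supremum in \<open>real\<close> is meaningful only for a bounded set; finiteness of the supremum
  has to be asserted separately through \<open>bdd_above\<close>.
\<close>
definition hermite_sup :: "nat \<Rightarrow> real \<Rightarrow> real" where
  "hermite_sup N t = (SUP s\<in>{0..}. weighted_hermite N t s)"

end

theory Submission
  imports Defs "HOL-Real_Asymp.Real_Asymp"
begin

text \<open>
  For fixed \<open>x > 0\<close> the function
  \<open>P u = (\<Sum>n<N. (-1)^n He\<^sub>n(u - x) / x^(n+1)) exp(-u\<^sup>2/2)\<close> has the telescoping derivative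
  \<open>((-1)^N He\<^sub>N(u - x) / x^N - 1) exp(-u\<^sup>2/2)\<close> and vanishes at infinity. Integrating from
  \<open>x + t\<close> to infinity gives the expansion with an exact remainder integral. In that integral
  \<open>u = x + t + s\<close> turns the integrand into a multiple of the weighted Hermite function times
  \<open>exp(-x s)\<close>, whose integral is \<open>1 / x\<close>. Finally \<open>exp(-t s - s\<^sup>2/2)\<close> equals
  \<open>exp(t\<^sup>2/2) exp(-(s + t)\<^sup>2/2)\<close>, so all bounds are locally uniform in \<open>t\<close> because
  \<open>He\<^sub>N(y) exp(-y\<^sup>2/2)\<close> is bounded.
\<close>

section \<open>Recurrence and derivative of the Hermite polynomials\<close>

lemma hermite_0 [simp]: "hermite 0 y = 1"
  by (simp add: hermite_def)

text \<open>The generating series satisfies F' = (y - z) F; comparing the coefficients of z^n gives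
  the recurrence. For \<open>n = 0\<close> the truncated index \<open>n - 1\<close> is harmless
  because its factor is zero.\<close>

lemma hermite_Suc:
  "hermite (Suc n) y = y * hermite n y - real n * hermite (n - 1) y"
proof -
  define F where "F = fps_exp (1::real) oo (fps_const y * fps_X - fps_const (1/2) * fps_X\<^sup>2)"
  have "fps_deriv F = (fps_const y - fps_X) * F"
    unfolding F_def
    by (subst fps_compose_deriv) (auto simp: power2_eq_square algebra_simps fps_numeral_fps_const simp flip: fps_const_mult)
  then have "fps_nth (fps_deriv F) n = fps_nth ((fps_const y - fps_X) * F) n"
    by simp
  then have *: "real (Suc n) * fps_nth F (Suc n) = y * fps_nth F n - (if n = 0 then 0 else fps_nth F (n - 1))"
    by (simp add: left_diff_distrib)
  have H: "hermite k y = fact k * fps_nth F k" for k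
    by (simp add: hermite_def F_def)
  have "hermite (Suc n) y = fact n * (real (Suc n) * fps_nth F (Suc n))"
    by (simp add: H algebra_simps)
  also have "\<dots> = y * hermite n y - real n * hermite (n - 1) y"
    unfolding * by (cases n) (simp_all add: H algebra_simps)
  finally show ?thesis .
qed

text \<open>Differentiate the three-term recurrence. It reaches two indices down, hence strong
  induction.\<close>

lemma hermite_has_field_derivative:
  "(hermite n has_field_derivative real n * hermite (n - 1) y) (at y)"
proof (induction n rule: less_induct)
  case (less n)
  show ?case
  proof (cases n)
    case 0
    then show ?thesis by (simp add: fun_eq_iff[THEN iffD2, of "hermite 0" "\<lambda>_. 1"])
  next
    case (Suc m)
    have eq: "hermite n = (\<lambda>y. y * hermite m y - real m * hermite (m - 1) y)"
      using hermite_Suc Suc by blast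
    have low: "(hermite m has_field_derivative real m * hermite (m - 1) y) (at y)"
      "(hermite (m - 1) has_field_derivative real (m - 1) * hermite (m - 1 - 1) y) (at y)"
      using less[of m] less[of "m - 1"] Suc by auto
    have "((\<lambda>y. y * hermite m y - real m * hermite (m - 1) y) has_field_derivative
        (hermite m y + y * (real m * hermite (m - 1) y) -
          real m * (real (m - 1) * hermite (m - 1 - 1) y))) (at y)"
      using DERIV_diff[OF DERIV_mult[OF DERIV_ident low(1)] DERIV_cmult[OF low(2)]]
      by (simp add: mult.commute)
    moreover have "hermite m y + y * (real m * hermite (m - 1) y) -
          real m * (real (m - 1) * hermite (m - 1 - 1) y) = real n * hermite (n - 1) y"
    proof -
      \<comment> \<open>The derivatives recombine by the recurrence one index lower, which rebuilds
        \<open>hermite m y\<close>; for \<open>m = 0\<close> both sides vanish.\<close>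
      have "real m * (y * hermite (m - 1) y - real (m - 1) * hermite (m - 1 - 1) y) =
          real m * hermite m y"
        using hermite_Suc[of "m - 1" y] by (cases m) auto
      then show ?thesis using Suc by (simp add: algebra_simps)
    qed
    ultimately show ?thesis by (simp add: eq)
  qed
qed

lemma continuous_on_hermite [continuous_intros]:
  "continuous_on S f \<Longrightarrow> continuous_on S (\<lambda>x. hermite n (f x))"
  by (rule continuous_on_compose2[of UNIV "hermite n"])
    (auto intro: DERIV_continuous_on hermite_has_field_derivative)

section \<open>Boundedness against the Gaussian weight\<close>

lemma power_mult_gaussian_bounded: "\<exists>C. \<forall>y::real. \<bar>y\<bar> ^ k * exp (- y\<^sup>2 / 2) \<le> C"
proof (intro exI allI)
  fix y :: real
  \<comment> \<open>A single term of the exponential series with nonnegative terms is at most its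
    sum.\<close>
  have "(y\<^sup>2 / 2) ^ k /\<^sub>R fact k \<le> exp (y\<^sup>2 / 2)"
  proof -
    have "(\<Sum>n\<in>{k}. (y\<^sup>2 / 2) ^ n /\<^sub>R fact n) \<le> exp (y\<^sup>2 / 2)"
      unfolding exp_def by (intro sum_le_suminf summable_exp_generic) auto
    then show ?thesis by simp
  qed
  then have "(y\<^sup>2) ^ k \<le> 2 ^ k * fact k * exp (y\<^sup>2 / 2)"
    by (simp add: power_divide field_simps)
  \<comment> \<open>The series term has degree 2k in y; expanding (|y|^k - 1)^2 >= 0 brings degree k
    below it.\<close>
  moreover have "\<bar>y\<bar> ^ k \<le> 1 + (y\<^sup>2) ^ k"
  proof -
    have "0 \<le> (\<bar>y\<bar> ^ k - 1)\<^sup>2" by simp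
    moreover have "(\<bar>y\<bar> ^ k)\<^sup>2 = (y\<^sup>2) ^ k"
      by (metis power2_abs power_mult mult.commute)
    moreover have "0 \<le> \<bar>y\<bar> ^ k" "0 \<le> (y\<^sup>2) ^ k" by simp_all
    ultimately show ?thesis unfolding power2_diff power_one by linarith
  qed
  moreover have "1 \<le> exp (y\<^sup>2 / 2)" by (subst one_le_exp_iff) simp
  ultimately have "\<bar>y\<bar> ^ k \<le> (1 + 2 ^ k * fact k) * exp (y\<^sup>2 / 2)"
    unfolding distrib_right by linarith
  then show "\<bar>y\<bar> ^ k * exp (- y\<^sup>2 / 2) \<le> 1 + 2 ^ k * fact k"
    by (simp add: exp_minus field_simps)
qed

text \<open>The recurrence multiplies by y, so the induction needs the extra power of |y| with
  \<open>k\<close> arbitrary: a bound for index \<open>m\<close> with \<open>Suc k\<close> feeds the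
  one for \<open>Suc m\<close> with \<open>k\<close>.\<close>

lemma power_mult_hermite_gaussian_bounded:
  "\<exists>C. \<forall>y. \<bar>y\<bar> ^ k * \<bar>hermite n y\<bar> * exp (- y\<^sup>2 / 2) \<le> C"
proof (induction n arbitrary: k rule: less_induct)
  case (less n)
  show ?case
  proof (cases n)
    case 0
    then show ?thesis using power_mult_gaussian_bounded[of k] by simp
  next
    case (Suc m)
    obtain A where A: "\<And>y. \<bar>y\<bar> ^ Suc k * \<bar>hermite m y\<bar> * exp (- y\<^sup>2 / 2) \<le> A"
      using less[of m "Suc k"] Suc by blast
    obtain B where B: "\<And>y. \<bar>y\<bar> ^ k * \<bar>hermite (m - 1) y\<bar> * exp (- y\<^sup>2 / 2) \<le> B"
      using less[of "m - 1" k] Suc by (metis diff_le_self le_imp_less_Suc)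
    have "\<bar>y\<bar> ^ k * \<bar>hermite n y\<bar> * exp (- y\<^sup>2 / 2) \<le> A + real m * B" for y
    proof -
      have "\<bar>hermite n y\<bar> \<le> \<bar>y\<bar> * \<bar>hermite m y\<bar> + real m * \<bar>hermite (m - 1) y\<bar>"
        using abs_triangle_ineq4[of "y * hermite m y" "real m * hermite (m - 1) y"]
        by (simp add: Suc hermite_Suc abs_mult)
      then have "\<bar>y\<bar> ^ k * exp (- y\<^sup>2 / 2) * \<bar>hermite n y\<bar> \<le>
          \<bar>y\<bar> ^ k * exp (- y\<^sup>2 / 2) * (\<bar>y\<bar> * \<bar>hermite m y\<bar> + real m * \<bar>hermite (m - 1) y\<bar>)"
        by (rule mult_left_mono) simp
      also have "\<dots> = \<bar>y\<bar> ^ Suc k * \<bar>hermite m y\<bar> * exp (- y\<^sup>2 / 2) +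
          real m * (\<bar>y\<bar> ^ k * \<bar>hermite (m - 1) y\<bar> * exp (- y\<^sup>2 / 2))"
        by (simp add: algebra_simps)
      also have "\<dots> \<le> A + real m * B"
        by (intro add_mono A mult_left_mono B) simp
      finally show ?thesis by (simp add: mult_ac)
    qed
    then show ?thesis by blast
  qed
qed

lemma weighted_hermite_eq:
  "weighted_hermite n t s = exp (t\<^sup>2 / 2) * (\<bar>hermite n (s + t)\<bar> * exp (- (s + t)\<^sup>2 / 2))"
proof -
  have "- t * s - s\<^sup>2 / 2 = t\<^sup>2 / 2 + - (s + t)\<^sup>2 / 2"
    by (simp add: power2_eq_square field_simps)
  then show ?thesis
    unfolding weighted_hermite_def by (simp only: exp_add mult_ac)
qed

text \<open>After completing the square, t enters only through exp(t^2/2) and the shifted argument s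
  + t, so one constant serves all t and s. This yields both finiteness of the supremum and local
  uniformity in t.\<close>

lemma weighted_hermite_bounded:
  obtains C where "C \<ge> 0" "\<And>t s. weighted_hermite n t s \<le> C * exp (t\<^sup>2 / 2)"
proof -
  obtain C where C: "\<And>y. \<bar>hermite n y\<bar> * exp (- y\<^sup>2 / 2) \<le> C"
    using power_mult_hermite_gaussian_bounded[of 0 n] by auto
  show thesis
  proof
    show "C \<ge> 0" using C[of 0] by (smt (verit) mult_nonneg_nonneg abs_ge_zero exp_ge_zero)
    show "weighted_hermite n t s \<le> C * exp (t\<^sup>2 / 2)" for t s
      using mult_left_mono[OF C[of "s + t"], of "exp (t\<^sup>2 / 2)"]
      by (simp add: weighted_hermite_eq mult.commute)
  qed
qed

lemma bdd_above_weighted_hermite: "bdd_above (weighted_hermite n t ` S)"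
  by (metis weighted_hermite_bounded bdd_above.I2)

lemma weighted_hermite_le_hermite_sup: "s \<ge> 0 \<Longrightarrow> weighted_hermite n t s \<le> hermite_sup n t"
  unfolding hermite_sup_def by (rule cSUP_upper) (auto intro: bdd_above_weighted_hermite)

section \<open>Exponential majorant and tail integrals\<close>

lemma hermite_gaussian_le:
  assumes "u \<ge> x + t"
  shows "\<bar>hermite n (u - x) * exp (- u\<^sup>2 / 2)\<bar> \<le>
    hermite_sup n t * exp (- (x + t)\<^sup>2 / 2) * exp (- x * (u - (x + t)))"
proof -
  define s where "s = u - (x + t)"
  have u: "u = s + t + x" by (simp add: s_def)
  have "- u\<^sup>2 / 2 = (- t * s - s\<^sup>2 / 2) + - (x + t)\<^sup>2 / 2 + - x * s"
    by (simp add: u power2_eq_square field_simps)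
  then have "exp (- u\<^sup>2 / 2) = exp (- t * s - s\<^sup>2 / 2) * exp (- (x + t)\<^sup>2 / 2) * exp (- x * s)"
    by (simp only: exp_add)
  moreover have "hermite n (u - x) = hermite n (s + t)" by (simp add: u)
  ultimately have "\<bar>hermite n (u - x) * exp (- u\<^sup>2 / 2)\<bar> =
      weighted_hermite n t s * (exp (- (x + t)\<^sup>2 / 2) * exp (- x * s))"
    by (simp add: weighted_hermite_def abs_mult mult_ac)
  also have "\<dots> \<le> hermite_sup n t * (exp (- (x + t)\<^sup>2 / 2) * exp (- x * s))"
    using assms by (intro mult_right_mono weighted_hermite_le_hermite_sup) (auto simp: s_def)
  finally show ?thesis by (simp add: s_def mult_ac)
qed

text \<open>The antiderivative -exp(-x(u - z))/x tends to -1/x at z and to 0 at infinity. As the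
  integrand is nonnegative, the fundamental theorem delivers integrability along with the
  value.\<close>

lemma exp_tail_integral:
  fixes x z :: real
  assumes "x > 0"
  shows "set_integrable lborel {z<..} (\<lambda>u. exp (- x * (u - z)))"
    and "(LBINT u:{z<..}. exp (- x * (u - z))) = 1 / x"
proof -
  have D: "((\<lambda>u. - exp (- x * (u - z)) / x) has_real_derivative exp (- x * (u - z))) (at u)" for u
    using assms by (auto intro!: derivative_eq_intros simp: field_simps)
  have A: "(((\<lambda>u. - exp (- x * (u - z)) / x) \<circ> real_of_ereal) \<longlongrightarrow> - 1 / x) (at_right (ereal z))"
    unfolding ereal_tendsto_simps by (auto intro!: tendsto_eq_intros simp: assms less_imp_neq[symmetric])
  have "((\<lambda>u. - exp (- x * (u - z)) / x) \<longlongrightarrow> 0) at_top"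
    using assms by real_asymp
  then have B: "(((\<lambda>u. - exp (- x * (u - z)) / x) \<circ> real_of_ereal) \<longlongrightarrow> 0) (at_left \<infinity>)"
    unfolding ereal_tendsto_simps .
  note FTC = interval_integral_FTC_nonneg[of "ereal z" \<infinity>, OF _ D _ _ A B]
  show "set_integrable lborel {z<..} (\<lambda>u. exp (- x * (u - z)))"
    using FTC(1) by (simp add: continuous_intros)
  show "(LBINT u:{z<..}. exp (- x * (u - z))) = 1 / x"
    using FTC(2) by (simp add: continuous_intros interval_integral_to_infinity_eq)
qed

text \<open>One majorant, a constant times exp(-x(u - (x + t))), gives integrability, the integral
  bound and decay at infinity.\<close>

lemma hermite_gaussian_tail:
  assumes "x > 0"
  shows "set_integrable lborel {x + t<..} (\<lambda>u. hermite n (u - x) * exp (- u\<^sup>2 / 2))"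
    and "\<bar>LBINT u:{x + t<..}. hermite n (u - x) * exp (- u\<^sup>2 / 2)\<bar> \<le>
      hermite_sup n t * exp (- (x + t)\<^sup>2 / 2) / x"
    and "((\<lambda>u. hermite n (u - x) * exp (- u\<^sup>2 / 2)) \<longlongrightarrow> 0) at_top"
proof -
  define K where "K = hermite_sup n t * exp (- (x + t)\<^sup>2 / 2)"
  define f where "f u = hermite n (u - x) * exp (- u\<^sup>2 / 2)" for u
  define e where "e u = K * exp (- x * (u - (x + t)))" for u
  have le: "\<bar>f u\<bar> \<le> e u" if "u \<ge> x + t" for u
    using hermite_gaussian_le[OF that] by (simp add: K_def f_def e_def)
  have e: "set_integrable lborel {x + t<..} e"
    unfolding e_def by (rule set_integrable_mult_right) (rule exp_tail_integral[OF assms])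
  have "continuous_on UNIV f"
    unfolding f_def by (intro continuous_intros) auto
  then have [measurable]: "f \<in> borel_measurable borel"
    by (rule borel_measurable_continuous_onI)
  show f: "set_integrable lborel {x + t<..} f"
    by (rule set_integrable_bound[OF e]) (use le in \<open>auto simp: set_borel_measurable_def intro!: AE_I2 order_trans[OF le]\<close>)
  have "\<bar>LBINT u:{x + t<..}. f u\<bar> \<le> (LBINT u:{x + t<..}. \<bar>f u\<bar>)"
    using set_integral_norm_bound[OF f] by simp
  also have "\<dots> \<le> (LBINT u:{x + t<..}. e u)"
    by (rule set_integral_mono) (use f e le in \<open>auto intro: set_integrable_abs\<close>)
  also have "\<dots> = K / x"
    unfolding e_def using exp_tail_integral(2)[OF assms, of "x + t"] by simp
  finally show "\<bar>LBINT u:{x + t<..}. f u\<bar> \<le> K / x" .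
  show "(f \<longlongrightarrow> 0) at_top"
  proof (rule Lim_null_comparison)
    show "\<forall>\<^sub>F u in at_top. norm (f u) \<le> e u"
      using eventually_ge_at_top[of "x + t"] by eventually_elim (simp add: le)
    have "((\<lambda>u. exp (- x * (u - (x + t)))) \<longlongrightarrow> 0) at_top"
      using assms by real_asymp
    then show "(e \<longlongrightarrow> 0) at_top"
      unfolding e_def by (rule tendsto_mult_right_zero)
  qed
qed

section \<open>Telescoping antiderivative and the exact remainder\<close>

lemma hermite_gaussian_has_derivative:
  "((\<lambda>u. hermite n (u - x) * exp (- u\<^sup>2 / 2)) has_real_derivative
     - (hermite (Suc n) (u - x) + x * hermite n (u - x)) * exp (- u\<^sup>2 / 2)) (at u)"
proof -
  have "((\<lambda>u. hermite n (u - x)) has_real_derivative real n * hermite (n - 1) (u - x)) (at u)"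
    using DERIV_chain2[OF hermite_has_field_derivative, of "\<lambda>u. u - x" 1 u UNIV n]
    by (simp add: DERIV_diff[where E = 0, simplified])
  \<comment> \<open>The product rule produces -u times the Hermite factor; splitting u = (u - x) + x
    lets the recurrence absorb the first part and leaves the term with factor x.\<close>
  then show ?thesis
    by (auto intro!: derivative_eq_intros simp: hermite_Suc algebra_simps)
qed

lemma mills_expansion_antiderivative:
  assumes "x > 0"
  shows "((\<lambda>u. \<Sum>n<N. (-1) ^ n / x ^ (n + 1) * (hermite n (u - x) * exp (- u\<^sup>2 / 2)))
    has_real_derivative
      (-1) ^ N / x ^ N * (hermite N (u - x) * exp (- u\<^sup>2 / 2)) - exp (- u\<^sup>2 / 2)) (at u)"
proof -
  \<comment> \<open>The coefficients (-1)^n / x^(n+1) make each summand's derivative a difference of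
    consecutive \<open>a\<close>. The end terms are the Mills integrand \<open>a 0\<close> and the
    remainder integrand \<open>a N\<close>.\<close>
  define a where "a n = (-1) ^ n / x ^ n * (hermite n (u - x) * exp (- u\<^sup>2 / 2))" for n
  have "(-1) ^ n / x ^ (n + 1) * (- (hermite (Suc n) (u - x) + x * hermite n (u - x)) * exp (- u\<^sup>2 / 2))
      = a (Suc n) - a n" for n
    using assms by (simp add: a_def field_simps)
  then have "(\<Sum>n<N. (-1) ^ n / x ^ (n + 1) *
      (- (hermite (Suc n) (u - x) + x * hermite n (u - x)) * exp (- u\<^sup>2 / 2))) = a N - a 0"
    by (simp add: sum_lessThan_telescope)
  moreover have "((\<lambda>u. \<Sum>n<N. (-1) ^ n / x ^ (n + 1) * (hermite n (u - x) * exp (- u\<^sup>2 / 2)))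
    has_real_derivative (\<Sum>n<N. (-1) ^ n / x ^ (n + 1) *
      (- (hermite (Suc n) (u - x) + x * hermite n (u - x)) * exp (- u\<^sup>2 / 2)))) (at u)"
    by (intro DERIV_sum DERIV_cmult hermite_gaussian_has_derivative)
  ultimately show ?thesis
    by (simp add: a_def)
qed

lemma mills_remainder_eq_integral:
  assumes "x > 0"
  shows "mills_remainder N x t = (-1) ^ N / x ^ N * exp ((x + t)\<^sup>2 / 2) *
    (LBINT u:{x + t<..}. hermite N (u - x) * exp (- u\<^sup>2 / 2))"
proof -
  define z where "z = x + t"
  define P where "P u = (\<Sum>n<N. (-1) ^ n / x ^ (n + 1) * (hermite n (u - x) * exp (- u\<^sup>2 / 2)))" for u
  define f where "f u = hermite N (u - x) * exp (- u\<^sup>2 / 2)" for u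
  define p where "p u = (-1) ^ N / x ^ N * f u - exp (- u\<^sup>2 / 2)" for u
  have D: "(P has_real_derivative p u) (at u)" for u
    unfolding P_def p_def f_def by (rule mills_expansion_antiderivative[OF assms])
  have f: "set_integrable lborel {z<..} f"
    unfolding f_def z_def by (rule hermite_gaussian_tail[OF assms])
  \<comment> \<open>This is the case of index 0, where the Hermite factor is 1.\<close>
  have g: "set_integrable lborel {z<..} (\<lambda>u::real. exp (- u\<^sup>2 / 2))"
    using hermite_gaussian_tail(1)[OF assms, of t 0] by (simp add: z_def)
  have pint: "set_integrable lborel {z<..} p"
    unfolding p_def by (intro set_integral_diff set_integrable_mult_right f g)
  have "continuous_on UNIV p"
    unfolding p_def f_def by (intro continuous_intros) auto
  then have cont: "isCont p u" for u
    by (simp add: continuous_on_eq_continuous_at)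
  have "(P \<longlongrightarrow> P z) (at_right z)"
    using DERIV_isCont[OF D] by (simp add: isCont_def filterlim_at_split)
  then have A: "((P \<circ> real_of_ereal) \<longlongrightarrow> P z) (at_right (ereal z))"
    unfolding ereal_tendsto_simps .
  have "(P \<longlongrightarrow> 0) at_top"
    unfolding P_def
    by (rule tendsto_null_sum, rule tendsto_mult_right_zero, rule hermite_gaussian_tail[OF assms])
  then have B: "((P \<circ> real_of_ereal) \<longlongrightarrow> 0) (at_left \<infinity>)"
    unfolding ereal_tendsto_simps .
  have "(LBINT u=ereal z..\<infinity>. p u) = 0 - P z"
    by (rule interval_integral_FTC_integrable[OF _ _ _ _ A B])
      (use D cont pint in \<open>auto simp: has_real_derivative_iff_has_vector_derivative\<close>)
  then have "(LBINT u:{z<..}. p u) = - P z"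
    by (simp add: interval_integral_to_infinity_eq)
  moreover have "(LBINT u:{z<..}. p u) =
      (-1) ^ N / x ^ N * (LBINT u:{z<..}. f u) - (LBINT u:{z<..}. exp (- u\<^sup>2 / 2))"
    unfolding p_def using f g by (simp add: set_integral_diff)
  \<comment> \<open>\<open>mills_eq_integral\<close> uses the closed half-line; the endpoint is a
    null set.\<close>
  moreover have "(LBINT u:{z..}. exp (- u\<^sup>2 / 2)) = (LBINT u:{z<..}. exp (- u\<^sup>2 / 2))"
    unfolding set_lebesgue_integral_def
  proof (rule integral_cong_AE)
    show "AE u in lborel. indicator {z..} u *\<^sub>R exp (- u\<^sup>2 / 2) =
        indicator {z<..} u *\<^sub>R exp (- u\<^sup>2 / 2)"
      using AE_lborel_singleton[of z] by eventually_elim (simp add: indicator_def)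
  qed simp_all
  ultimately have "(LBINT u:{z..}. exp (- u\<^sup>2 / 2)) =
      P z + (-1) ^ N / x ^ N * (LBINT u:{z<..}. f u)"
    by linarith
  then have "mills z = exp (z\<^sup>2 / 2) * P z +
      (-1) ^ N / x ^ N * exp (z\<^sup>2 / 2) * (LBINT u:{z<..}. f u)"
    by (simp only: mills_eq_integral distrib_left mult_ac)
  \<comment> \<open>At u = z = x + t the Hermite argument u - x is t, and the Gaussian factor of
    \<open>P\<close> cancels the prefactor.\<close>
  moreover have "exp (z\<^sup>2 / 2) * P z = (\<Sum>n<N. (-1) ^ n * (hermite n t / x ^ (n + 1)))"
    by (simp add: P_def sum_distrib_left z_def exp_minus field_simps)
  ultimately show ?thesis
    by (simp add: mills_remainder_def f_def z_def)
qed

section \<open>Pointwise and locally uniform remainder bounds\<close>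

lemma abs_mills_remainder_le:
  assumes "x > 0"
  shows "\<bar>mills_remainder N x t\<bar> \<le> hermite_sup N t / x ^ (N + 1)"
proof -
  have "\<bar>mills_remainder N x t\<bar> = exp ((x + t)\<^sup>2 / 2) / x ^ N *
      \<bar>LBINT u:{x + t<..}. hermite N (u - x) * exp (- u\<^sup>2 / 2)\<bar>"
    using assms by (simp add: mills_remainder_eq_integral abs_mult power_abs)
  also have "\<dots> \<le> exp ((x + t)\<^sup>2 / 2) / x ^ N * (hermite_sup N t * exp (- (x + t)\<^sup>2 / 2) / x)"
    using assms by (intro mult_left_mono hermite_gaussian_tail) auto
  also have "\<dots> = hermite_sup N t / x ^ (N + 1)"
    by (simp add: exp_minus field_simps)
  finally show ?thesis .
qed

lemma abs_mills_remainder_locally_uniform: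
  obtains K where "K \<ge> 0"
    and "\<And>x t. x > 0 \<Longrightarrow> t \<in> {a..b} \<Longrightarrow> \<bar>mills_remainder N x t\<bar> \<le> K / x ^ (N + 1)"
proof -
  obtain C where C: "C \<ge> 0" "\<And>t s. weighted_hermite N t s \<le> C * exp (t\<^sup>2 / 2)"
    using weighted_hermite_bounded[of N] by blast
  \<comment> \<open>On [a, b] the square t^2 is at most a^2 or b^2, hence at most their sum, so
    \<open>K\<close> dominates C exp(t^2/2) there.\<close>
  define K where "K = C * exp ((a\<^sup>2 + b\<^sup>2) / 2)"
  show thesis
  proof
    show "K \<ge> 0" using C by (simp add: K_def)
    fix x t :: real
    assume "x > 0" and t: "t \<in> {a..b}"
    have "\<bar>t\<bar> \<le> \<bar>a\<bar> \<or> \<bar>t\<bar> \<le> \<bar>b\<bar>" using t by auto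
    then have "t\<^sup>2 \<le> a\<^sup>2 + b\<^sup>2"
      by (metis abs_le_square_iff add_increasing add_increasing2 zero_le_power2)
    then have "C * exp (t\<^sup>2 / 2) \<le> K"
      using C(1) by (simp add: K_def mult_left_mono)
    then have "hermite_sup N t \<le> K"
      unfolding hermite_sup_def by (intro cSUP_least) (auto intro: order_trans[OF C(2)])
    then show "\<bar>mills_remainder N x t\<bar> \<le> K / x ^ (N + 1)"
      using \<open>x > 0\<close> by (intro order_trans[OF abs_mills_remainder_le] divide_right_mono) auto
  qed
qed

theorem theorem3p2:
  fixes N :: nat
  assumes "N \<ge> 1"
  shows "(\<forall>x t :: real. x > 0 \<longrightarrow>
            mills (x + t) =
              (\<Sum>n<N. (-1) ^ n * (hermite n t / x ^ (n + 1))) + mills_remainder N x t \<and>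
            bdd_above (weighted_hermite N t ` {0..}) \<and>
            \<bar>mills_remainder N x t\<bar> \<le> hermite_sup N t / x ^ (N + 1)) \<and>
         (\<forall>a b :: real. a \<le> b \<longrightarrow>
            (\<forall>x>0. bdd_above ((\<lambda>t. \<bar>mills_remainder N x t\<bar>) ` {a..b})) \<and>
            (\<lambda>x. SUP t\<in>{a..b}. \<bar>mills_remainder N x t\<bar>) \<in> O[at_top](\<lambda>x. 1 / x ^ (N + 1)))"
proof (intro conjI allI impI)
  fix x t :: real
  assume "x > 0"
  show "mills (x + t) =
      (\<Sum>n<N. (-1) ^ n * (hermite n t / x ^ (n + 1))) + mills_remainder N x t"
    by (simp add: mills_remainder_def)
  show "bdd_above (weighted_hermite N t ` {0..})"
    by (rule bdd_above_weighted_hermite)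
  show "\<bar>mills_remainder N x t\<bar> \<le> hermite_sup N t / x ^ (N + 1)"
    using \<open>x > 0\<close> by (rule abs_mills_remainder_le)
next
  fix a b :: real
  assume "a \<le> b"
  obtain K where K: "K \<ge> 0"
    "\<And>x t. x > 0 \<Longrightarrow> t \<in> {a..b} \<Longrightarrow> \<bar>mills_remainder N x t\<bar> \<le> K / x ^ (N + 1)"
    using abs_mills_remainder_locally_uniform[of a b N] by blast
  show bdd: "bdd_above ((\<lambda>t. \<bar>mills_remainder N x t\<bar>) ` {a..b})" if "x > 0" for x
    using K(2)[OF that] by (rule bdd_above.I2)
  show "(\<lambda>x. SUP t\<in>{a..b}. \<bar>mills_remainder N x t\<bar>) \<in> O[at_top](\<lambda>x. 1 / x ^ (N + 1))"
  proof (rule bigoI)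
    show "\<forall>\<^sub>F x in at_top. norm (SUP t\<in>{a..b}. \<bar>mills_remainder N x t\<bar>) \<le> K * norm (1 / x ^ (N + 1))"
      using eventually_gt_at_top[of 0]
    proof eventually_elim
      case (elim x)
      \<comment> \<open>Nonnegativity of the supremum, witnessed at the endpoint \<open>a\<close>,
        removes the norm in the big-O condition.\<close>
      have "0 \<le> \<bar>mills_remainder N x a\<bar>" by simp
      also have "\<dots> \<le> (SUP t\<in>{a..b}. \<bar>mills_remainder N x t\<bar>)"
        using \<open>a \<le> b\<close> by (intro cSUP_upper bdd elim) auto
      finally have "0 \<le> (SUP t\<in>{a..b}. \<bar>mills_remainder N x t\<bar>)" .
      moreover have "(SUP t\<in>{a..b}. \<bar>mills_remainder N x t\<bar>) \<le> K / x ^ (N + 1)"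
        using \<open>a \<le> b\<close> K(2)[OF elim] by (intro cSUP_least) auto
      ultimately show ?case using elim by simp
    qed
  qed
qed

end
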